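(* Let $\Gamma$ be a torsion-free finite index subgroup of $\mathrm{SL}_n\mathbb Z$ and let $N\subset\mathrm{SL}_n\mathbb R$ be a subset (a manifold) such that the map $N\to M_\Gamma$, $x\mapsto[x]$, is proper. Then for every $B\in\mathrm{SL}_n\mathbb R$, the maps $N\to M_\Gamma$, $x\mapsto[x]$ and $x\mapsto[Bx]$, are properly homotopic.
   Context: $S_n=\mathrm{SO}_n\backslash\mathrm{SL}_n\mathbb R$ with the right action of $\mathrm{SL}_n\mathbb R$; $M_\Gamma=\mathrm{SO}_n\backslash\mathrm{SL}_n\mathbb R/\Gamma$ and $[x]$ denotes the image of $x\in\mathrm{SL}_n\mathbb R$ in $M_\Gamma$. A proper homotopy is a homotopy $N\times[0,1]\to M_\Gamma$ that is a proper map. *)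

theory Defs
  imports "HOL-Analysis.Analysis"
begin

text \<open>Matrices are elements of real^'n^'n; the dimension n = CARD('n) is arbitrary.\<close>

definition SL_R :: "(real^'n^'n) set" where
  "SL_R = {A. det A = 1}"

definition SO_R :: "(real^'n^'n) set" where
  "SO_R = {A. orthogonal_matrix A \<and> det A = 1}"

definition SL_Z :: "(real^'n^'n) set" where
  "SL_Z = {A \<in> SL_R. \<forall>i j. A $ i $ j \<in> \<int>}"

definition is_subgroup_SL_Z :: "(real^'n^'n) set \<Rightarrow> bool" where
  "is_subgroup_SL_Z G \<longleftrightarrow> G \<subseteq> SL_Z \<and> mat 1 \<in> G \<and>
     (\<forall>a\<in>G. \<forall>b\<in>G. a ** b \<in> G) \<and> (\<forall>a\<in>G. matrix_inv a \<in> G)"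

text \<open>Finitely many left cosets g G of G in SL_n Z.\<close>
definition finite_index_SL_Z :: "(real^'n^'n) set \<Rightarrow> bool" where
  "finite_index_SL_Z G \<longleftrightarrow> finite {(\<lambda>h. g ** h) ` G | g. g \<in> SL_Z}"

definition torsion_free :: "(real^'n^'n) set \<Rightarrow> bool" where
  "torsion_free G \<longleftrightarrow>
     (\<forall>g\<in>G. \<forall>k::nat. k > 0 \<longrightarrow> (((**) g) ^^ k) (mat 1) = mat 1 \<longrightarrow> g = mat 1)"

text \<open>The class [x] of x in M_Gamma = SO_n \ SL_n R / Gamma (a double coset).\<close>
definition cls :: "(real^'n^'n) set \<Rightarrow> real^'n^'n \<Rightarrow> (real^'n^'n) set" where
  "cls G x = {k ** x ** g | k g. k \<in> SO_R \<and> g \<in> G}"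

text \<open>Quotient topology induced by a map f from a space X.\<close>
definition quotient_topology :: "'a topology \<Rightarrow> ('a \<Rightarrow> 'b) \<Rightarrow> 'b topology" where
  "quotient_topology X f =
     topology (\<lambda>U. U \<subseteq> f ` topspace X \<and> openin X {x \<in> topspace X. f x \<in> U})"

text \<open>M_Gamma with the quotient topology from SL_n R.\<close>
definition M_top :: "(real^'n^'n) set \<Rightarrow> (real^'n^'n) set topology" where
  "M_top G = quotient_topology (top_of_set SL_R) (cls G)"

end

theory Submission
  imports Defs
begin

text \<open>
  Proof idea.  Since SL_n R is path connected, there is a path h from the identity to B inside
  SL_n R, and H(x, t) = [h(t) x] is a homotopy from x \<mapsto> [x] to x \<mapsto> [B x].  The whole work
  is to show that H is proper, i.e. a closed map with compact fibres.  Both properties reduce to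
  one compactness statement: for a compact set K of SL_n R, the set of (x, t) with
  [h(t) x] \<in> [K] is compact.  Writing h(t) x = k y g (k \<in> SO_n, y \<in> K, g \<in> \<Gamma>), the point x lies
  in the preimage of a compact subset of M_\<Gamma> under the proper map x \<mapsto> [x], hence in a compact
  set P; and then g ranges over a bounded, hence finite, set of integer matrices.
\<close>

subsection \<open>The quotient topology\<close>

lemma istopology_quotient:
  "istopology (\<lambda>U. U \<subseteq> f ` topspace X \<and> openin X {x \<in> topspace X. f x \<in> U})"
  unfolding istopology_def
proof (intro conjI; intro allI impI)
  fix S T assume S: "S \<subseteq> f ` topspace X \<and> openin X {x \<in> topspace X. f x \<in> S}"
    and T: "T \<subseteq> f ` topspace X \<and> openin X {x \<in> topspace X. f x \<in> T}"
  have "{x \<in> topspace X. f x \<in> S \<inter> T} = {x \<in> topspace X. f x \<in> S} \<inter> {x \<in> topspace X. f x \<in> T}"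
    by auto
  then show "S \<inter> T \<subseteq> f ` topspace X \<and> openin X {x \<in> topspace X. f x \<in> S \<inter> T}"
    using S T by (auto simp del: Collect_conj_eq)
next
  fix K assume K: "\<forall>S\<in>K. S \<subseteq> f ` topspace X \<and> openin X {x \<in> topspace X. f x \<in> S}"
  have "{x \<in> topspace X. f x \<in> \<Union>K} = (\<Union>S\<in>K. {x \<in> topspace X. f x \<in> S})"
    by auto
  then show "\<Union>K \<subseteq> f ` topspace X \<and> openin X {x \<in> topspace X. f x \<in> \<Union>K}"
    using K by auto
qed

text \<open>The open sets, the underlying set and the quotient-map property of the quotient topology.\<close>
lemma openin_quotient_topology:
  "openin (quotient_topology X f) U \<longleftrightarrow> U \<subseteq> f ` topspace X \<and> openin X {x \<in> topspace X. f x \<in> U}"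
  unfolding quotient_topology_def by (simp add: topology_inverse'[OF istopology_quotient])

lemma topspace_quotient_topology: "topspace (quotient_topology X f) = f ` topspace X"
proof -
  have "{x \<in> topspace X. f x \<in> f ` topspace X} = topspace X"
    by auto
  then have "openin (quotient_topology X f) (f ` topspace X)"
    unfolding openin_quotient_topology by simp
  then have "f ` topspace X \<subseteq> topspace (quotient_topology X f)"
    by (rule openin_subset)
  moreover have "topspace (quotient_topology X f) \<subseteq> f ` topspace X"
    using openin_topspace[of "quotient_topology X f"] unfolding openin_quotient_topology by blast
  ultimately show ?thesis
    by blast
qed

text \<open>The quotient topology makes f a quotient map; this gives access to the library theory.\<close>
lemma quotient_map_quotient_topology: "quotient_map X (quotient_topology X f) f"
  unfolding quotient_map_def topspace_quotient_topology openin_quotient_topology by simp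

text \<open>The projection x \<mapsto> [x] from SL_n R onto M_\<Gamma> is a quotient map (continuous and onto).\<close>
lemma quotient_map_cls: "quotient_map (top_of_set SL_R) (M_top \<Gamma>) (cls \<Gamma>)"
  unfolding M_top_def by (rule quotient_map_quotient_topology)

lemma topspace_M_top: "topspace (M_top \<Gamma>) = cls \<Gamma> ` SL_R"
  using quotient_imp_surjective_map[OF quotient_map_cls[of \<Gamma>]] by simp

subsection \<open>The groups SO_n, \<Gamma> and the double cosets [x]\<close>

lemma det1_inverse:
  fixes A :: "real^'n^'n"
  assumes "det A = 1"
  shows "A ** matrix_inv A = mat 1" "matrix_inv A ** A = mat 1"
proof -
  have "\<exists>A'. A ** A' = mat 1 \<and> A' ** A = mat 1"
    using assms invertible_det_nz unfolding invertible_def by fastforce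
  then have "A ** matrix_inv A = mat 1 \<and> matrix_inv A ** A = mat 1"
    unfolding matrix_inv_def by (rule someI_ex)
  then show "A ** matrix_inv A = mat 1" "matrix_inv A ** A = mat 1"
    by auto
qed

text \<open>Closure properties of SO_n and of the subgroup \<Gamma>, used to manipulate double cosets.\<close>
lemma SO_mult: "a \<in> SO_R \<Longrightarrow> b \<in> SO_R \<Longrightarrow> a ** b \<in> (SO_R :: (real^'n^'n) set)"
  by (simp add: SO_R_def orthogonal_matrix_mul det_mul)

lemma SO_transpose: "a \<in> SO_R \<Longrightarrow> transpose a \<in> (SO_R :: (real^'n^'n) set)"
  by (simp add: SO_R_def)

lemma SO_id: "mat 1 \<in> (SO_R :: (real^'n^'n) set)"
  by (simp add: SO_R_def orthogonal_matrix_id)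

lemma SO_transpose_mult: "a \<in> (SO_R :: (real^'n^'n) set) \<Longrightarrow> transpose a ** a = mat 1"
  by (simp add: SO_R_def orthogonal_matrix_def)

lemma SO_det: "a \<in> (SO_R :: (real^'n^'n) set) \<Longrightarrow> det a = 1"
  by (simp add: SO_R_def)

lemma subgroup_det: "is_subgroup_SL_Z \<Gamma> \<Longrightarrow> g \<in> \<Gamma> \<Longrightarrow> det (g::real^'n^'n) = 1"
  by (auto simp: is_subgroup_SL_Z_def SL_Z_def SL_R_def)

lemma subgroup_inverse:
  assumes "is_subgroup_SL_Z \<Gamma>" "g \<in> \<Gamma>"
  shows "matrix_inv g \<in> \<Gamma>" "g ** matrix_inv g = mat 1" "matrix_inv g ** (g::real^'n^'n) = mat 1"
  using assms det1_inverse[OF subgroup_det[OF assms]] by (auto simp: is_subgroup_SL_Z_def)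

lemma subgroup_mult: "is_subgroup_SL_Z \<Gamma> \<Longrightarrow> a \<in> \<Gamma> \<Longrightarrow> b \<in> \<Gamma> \<Longrightarrow> a ** b \<in> \<Gamma>"
  by (auto simp: is_subgroup_SL_Z_def)

lemma subgroup_id: "is_subgroup_SL_Z \<Gamma> \<Longrightarrow> mat 1 \<in> \<Gamma>"
  by (auto simp: is_subgroup_SL_Z_def)

lemma cls_iff: "z \<in> cls G x \<longleftrightarrow> (\<exists>k g. k \<in> SO_R \<and> g \<in> G \<and> z = k ** x ** g)"
  by (auto simp: cls_def)

text \<open>[k x g] = [x]: the classes are the double cosets SO_n x \<Gamma>.\<close>
lemma cls_eq:
  assumes \<Gamma>: "is_subgroup_SL_Z \<Gamma>" and k: "k \<in> SO_R" and g: "g \<in> \<Gamma>"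
  shows "cls \<Gamma> (k ** x ** g) = cls \<Gamma> x"
proof
  show "cls \<Gamma> (k ** x ** g) \<subseteq> cls \<Gamma> x"
  proof
    fix z assume "z \<in> cls \<Gamma> (k ** x ** g)"
    then obtain k' g' where "k' \<in> SO_R" "g' \<in> \<Gamma>" "z = (k' ** k) ** x ** (g ** g')"
      unfolding cls_iff by (auto simp: matrix_mul_assoc)
    then show "z \<in> cls \<Gamma> x"
      unfolding cls_iff using SO_mult subgroup_mult[OF \<Gamma>] k g by blast
  qed
next
  show "cls \<Gamma> x \<subseteq> cls \<Gamma> (k ** x ** g)"
  proof
    fix z assume "z \<in> cls \<Gamma> x"
    then obtain k' g' where k': "k' \<in> SO_R" and g': "g' \<in> \<Gamma>" and z: "z = k' ** x ** g'"
      unfolding cls_iff by blast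
    have "(k' ** transpose k) ** (k ** x ** g) ** (matrix_inv g ** g')
        = k' ** (transpose k ** k) ** x ** (g ** matrix_inv g) ** g'"
      by (simp add: matrix_mul_assoc)
    also have "\<dots> = z"
      using SO_transpose_mult[OF k] subgroup_inverse[OF \<Gamma> g] z by simp
    finally show "z \<in> cls \<Gamma> (k ** x ** g)"
      unfolding cls_iff using SO_mult[OF k' SO_transpose[OF k]]
        subgroup_mult[OF \<Gamma> subgroup_inverse(1)[OF \<Gamma> g] g'] by metis
  qed
qed

text \<open>Conversely, equal classes differ by an element of SO_n on the left and of \<Gamma> on the right.\<close>
lemma cls_eqD:
  assumes "is_subgroup_SL_Z \<Gamma>" "cls \<Gamma> z = cls \<Gamma> w"
  shows "\<exists>k g. k \<in> SO_R \<and> g \<in> \<Gamma> \<and> z = k ** w ** g"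
proof -
  have "z \<in> cls \<Gamma> z"
    unfolding cls_iff using SO_id subgroup_id[OF assms(1)] by fastforce
  then have "z \<in> cls \<Gamma> w"
    using assms(2) by simp
  then show ?thesis
    unfolding cls_iff .
qed

subsection \<open>Continuity of matrix operations\<close>

text \<open>Determinant and matrix product are polynomial, hence continuous, in the entries.\<close>
lemma continuous_on_det [continuous_intros]:
  fixes f :: "'a::topological_space \<Rightarrow> real^'n^'n"
  assumes "continuous_on S f"
  shows "continuous_on S (\<lambda>x. det (f x))"
  unfolding det_def by (intro continuous_intros assms)

lemma continuous_on_matrix_mult [continuous_intros]:
  fixes f :: "'a::topological_space \<Rightarrow> real^'m^'n" and g :: "'a \<Rightarrow> real^'k^'m"
  assumes "continuous_on S f" "continuous_on S g"
  shows "continuous_on S (\<lambda>x. f x ** g x)"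
  unfolding matrix_matrix_mult_def by (intro continuous_intros assms)

text \<open>
  The solution Z of X Z = Y for det X = 1, given by Cramer's rule; unlike matrix_inv, this
  formula is visibly continuous in X and Y.
\<close>
definition sl_solve :: "real^'n^'n \<Rightarrow> real^'n^'n \<Rightarrow> real^'n^'n" where
  "sl_solve X Y = (\<chi> i k. det (\<chi> r s. if s = i then Y$r$k else X$r$s))"

lemma continuous_on_sl_solve [continuous_intros]:
  fixes f g :: "'a::topological_space \<Rightarrow> real^'n^'n"
  assumes "continuous_on S f" "continuous_on S g"
  shows "continuous_on S (\<lambda>x. sl_solve (f x) (g x))"
proof -
  have "continuous_on S (\<lambda>x. if s = i then g x $ r $ k else f x $ r $ s)" for i k r s
    by (cases "s = i") (auto intro!: continuous_intros assms)
  then show ?thesis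
    unfolding sl_solve_def by (intro continuous_intros assms)
qed

text \<open>Cramer's rule: any solution of X Z = Y equals sl_solve X Y.\<close>
lemma sl_solve_unique:
  fixes X Y Z :: "real^'n^'n"
  assumes "det X = 1" "X ** Z = Y"
  shows "Z = sl_solve X Y"
proof -
  have "Z $ i $ k = sl_solve X Y $ i $ k" for i k
  proof -
    have "X *v (\<chi> j. Z$j$k) = (\<chi> r. Y$r$k)"
      using assms(2) by (auto simp: vec_eq_iff matrix_vector_mult_def matrix_matrix_mult_def)
    then have "(\<chi> j. Z$j$k) = (\<chi> l. det (\<chi> i j. if j = l then (\<chi> r. Y$r$k)$i else X$i$j) / det X)"
      using cramer[of X] assms(1) by simp
    moreover have "(\<lambda>r. \<chi> j. if j = i then (\<chi> r. Y$r$k)$r else X$r$j)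
        = (\<lambda>r. \<chi> s. if s = i then Y$r$k else X$r$s)"
      by (rule ext, rule arg_cong[where f=vec_lambda], rule ext) (simp only: vec_lambda_beta)
    ultimately show ?thesis
      using assms(1) by (simp add: vec_eq_iff sl_solve_def)
  qed
  then show ?thesis
    by (simp add: vec_eq_iff)
qed

text \<open>A solution exists, namely matrix_inv X ** Y.\<close>
lemma sl_solve_solves:
  fixes X Y :: "real^'n^'n"
  assumes "det X = 1"
  shows "X ** sl_solve X Y = Y"
proof -
  have "X ** (matrix_inv X ** Y) = Y"
    using det1_inverse[OF assms] by (simp add: matrix_mul_assoc)
  then show ?thesis
    using sl_solve_unique[OF assms] by metis
qed

text \<open>Solving within SL_n R stays in SL_n R.\<close>
lemma det_sl_solve:
  fixes X Y :: "real^'n^'n"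
  assumes "det X = 1" "det Y = 1"
  shows "det (sl_solve X Y) = 1"
  using det_mul[of X "sl_solve X Y"] sl_solve_solves[OF assms(1)] assms by simp

subsection \<open>SL_n R is path connected\<close>

text \<open>The shear matrix adding the combination sum_k u_k (row k) to row p (where u_p = 0).\<close>
definition shear :: "'n \<Rightarrow> real^'n \<Rightarrow> real^'n^'n" where
  "shear p u = mat 1 + (\<chi> i k. if i = p then u$k else 0)"

text \<open>A vector with vanishing p-th entry is a combination of the unit rows other than row p.\<close>
lemma in_span_other_rows:
  fixes x :: "real^'n"
  assumes "x $ p = 0"
  shows "x \<in> vec.span {row j (mat 1 :: real^'n^'n) |j. j \<noteq> p}"
proof -
  have "x = (\<Sum>j\<in>UNIV - {p}. x$j *s row j (mat 1 :: real^'n^'n))"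
  proof (rule vec_eq_iff[THEN iffD2], rule allI)
    fix i
    have "(\<Sum>j\<in>UNIV - {p}. x$j *s row j (mat 1 :: real^'n^'n)) $ i
        = (\<Sum>j\<in>UNIV - {p}. x$j * (if i = j then 1 else 0))"
      by (simp add: sum_component row_def mat_def eq_commute[of i])
    also have "\<dots> = (\<Sum>j\<in>UNIV - {p}. if i = j then x$j else 0)"
      by (rule sum.cong) auto
    also have "\<dots> = x $ i"
      using assms by (cases "i = p") (auto simp: sum.delta)
    finally show "x $ i = (\<Sum>j\<in>UNIV - {p}. x$j *s row j (mat 1 :: real^'n^'n)) $ i"
      by simp
  qed
  also have "\<dots> \<in> vec.span {row j (mat 1 :: real^'n^'n) |j. j \<noteq> p}"
    by (intro vec.span_sum vec.span_scale vec.span_base) auto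
  finally show ?thesis .
qed

text \<open>Shears have determinant 1, since they add to row p a combination of the other rows.\<close>
lemma det_shear:
  assumes "u $ p = 0"
  shows "det (shear p u) = 1"
proof -
  have "shear p u = (\<chi> k. if k = p then row p (mat 1) + u else row k (mat 1))"
    by (simp add: shear_def vec_eq_iff row_def mat_def)
  then show ?thesis
    by (simp add: det_row_span[OF in_span_other_rows[OF assms]])
qed

text \<open>Entries of shears and of their products with a matrix B on either side.\<close>
lemma shear_nth: "shear p u $ i $ k = (if i = k then 1 else 0) + (if i = p then u$k else 0)"
  by (simp add: shear_def mat_def)

lemma shear_mult_nth:
  "(shear p u ** B) $ i $ m = B$i$m + (if i = p then (\<Sum>r\<in>UNIV. u$r * B$r$m) else 0)"
proof -
  have "(shear p u ** B) $ i $ m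
      = (\<Sum>k\<in>UNIV. (if i = k then B$k$m else 0) + (if i = p then u$k * B$k$m else 0))"
    unfolding matrix_matrix_mult_def shear_nth by (simp add: distrib_right, intro sum.cong) auto
  then show ?thesis
    by (simp add: sum.distrib)
qed

lemma transpose_shear_mult_nth: "(transpose (shear p u) ** B) $ i $ m = B$i$m + u$i * B$p$m"
proof -
  have "(transpose (shear p u) ** B) $ i $ m
      = (\<Sum>k\<in>UNIV. (if i = k then B$k$m else 0) + (if k = p then u$i * B$k$m else 0))"
    unfolding matrix_matrix_mult_def transpose_def shear_nth
    by (simp add: distrib_right, intro sum.cong) auto
  then show ?thesis
    by (simp add: sum.distrib)
qed

lemma mult_shear_nth: "(B ** shear p u) $ i $ m = B$i$m + B$i$p * u$m"
proof -
  have "(B ** shear p u) $ i $ m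
      = (\<Sum>k\<in>UNIV. (if k = m then B$i$k else 0) + (if k = p then B$i$k * u$m else 0))"
    unfolding matrix_matrix_mult_def shear_nth by (simp add: distrib_left, intro sum.cong) auto
  then show ?thesis
    by (simp add: sum.distrib)
qed

text \<open>The segment t \<mapsto> shear p (t u) connects the identity to shear p u.\<close>
lemma continuous_on_shear [continuous_intros]: "continuous_on S (\<lambda>t::real. shear p (t *s u))"
proof -
  have "shear p (t *s u) = mat 1 + t *\<^sub>R (\<chi> i k. if i = p then u$k else 0)" for t
    by (simp add: shear_def vec_eq_iff)
  then show ?thesis
    by (simp only:) (intro continuous_intros)
qed

text \<open>Multiplying by the endpoint of a path of determinant-one matrices starting at 1.\<close>
lemma path_component_SL_mult:
  fixes A C :: "real^'n^'n" and e :: "real \<Rightarrow> real^'n^'n"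
  assumes "continuous_on {0..1} e" "\<And>t. t \<in> {0..1} \<Longrightarrow> det (e t) = 1" "e 0 = mat 1"
    and "det A = 1" "det C = 1"
  shows "path_component SL_R (A ** C) (A ** e 1 ** C)"
proof -
  let ?g = "\<lambda>t. A ** e t ** C"
  have "path ?g"
    unfolding path_def by (intro continuous_intros assms(1))
  moreover have "path_image ?g \<subseteq> SL_R"
    using assms(2,4,5) by (auto simp: path_image_def SL_R_def det_mul)
  ultimately show ?thesis
    using assms(3) unfolding path_component_def pathstart_def pathfinish_def by auto
qed

text \<open>Shears on either side (and transposed shears) do not leave the path component in SL_n R.\<close>
lemma path_component_SL_shear:
  fixes B :: "real^'n^'n"
  assumes "det B = 1" "u $ p = 0"
  shows "path_component SL_R B (shear p u ** B)"
    and "path_component SL_R B (transpose (shear p u) ** B)"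
    and "path_component SL_R B (B ** shear p u)"
proof -
  have det: "det (shear p (t *s u)) = 1" for t
    using assms(2) by (simp add: det_shear)
  have start: "shear p (0 *s u) = mat 1"
    by (simp add: shear_def vec_eq_iff)
  have "continuous_on {0..1} (\<lambda>t. transpose (shear p (t *s u)))"
    unfolding transpose_def by (intro continuous_intros)
  then show "path_component SL_R B (transpose (shear p u) ** B)"
    using path_component_SL_mult[of "\<lambda>t. transpose (shear p (t *s u))" "mat 1" B] assms(1) det start
    by simp
  show "path_component SL_R B (shear p u ** B)"
    using path_component_SL_mult[of "\<lambda>t. shear p (t *s u)" "mat 1" B] assms(1) det start
    by (simp add: continuous_on_shear)
  show "path_component SL_R B (B ** shear p u)"
    using path_component_SL_mult[of "\<lambda>t. shear p (t *s u)" B "mat 1"] assms(1) det start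
    by (simp add: continuous_on_shear)
qed

text \<open>All rows of B with index outside S are the corresponding rows of the identity matrix.\<close>
definition idrows :: "'n set \<Rightarrow> real^'n^'n \<Rightarrow> bool" where
  "idrows S B \<longleftrightarrow> (\<forall>i m. i \<notin> S \<longrightarrow> B$i$m = (if i = m then 1 else 0))"

text \<open>A matrix that differs from the identity only in row j has determinant A_jj.\<close>
lemma det_single_row:
  fixes A :: "real^'n^'n"
  assumes "idrows {j} A"
  shows "det A = A$j$j"
proof -
  define A' :: "real^'n^'n"
    where "A' = (\<chi> k. if k = j then A$j$j *s row j (mat 1) else row k (mat 1))"
  define w :: "real^'n" where "w = (\<chi> m. if m = j then 0 else A$j$m)"
  have "{row l A' |l. l \<noteq> j} = {row l (mat 1 :: real^'n^'n) |l. l \<noteq> j}"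
    by (auto simp: A'_def row_def)
  then have w: "w \<in> vec.span {row l A' |l. l \<noteq> j}"
    by (simp add: in_span_other_rows w_def)
  have "A = (\<chi> k. if k = j then row j A' + w else row k A')"
    using assms by (auto simp: idrows_def vec_eq_iff A'_def w_def row_def mat_def)
  then have "det A = det A'"
    using det_row_span[OF w] by simp
  also have "\<dots> = A$j$j * det (\<chi> k. if k = j then row j (mat 1 :: real^'n^'n) else row k (mat 1))"
    unfolding A'_def by (rule det_row_mul)
  also have "(\<chi> k. if k = j then row j (mat 1 :: real^'n^'n) else row k (mat 1)) = mat 1"
    by (simp add: vec_eq_iff row_def)
  finally show ?thesis
    by simp
qed

text \<open>Making the pivot B_jj equal to 1 by adding a multiple of a row l with B_lj \<noteq> 0.\<close>
lemma pivot_from_row: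
  fixes B :: "real^'n^'n"
  assumes "det B = 1" "idrows S B" "j \<in> S" "l \<noteq> j" "B$l$j \<noteq> 0"
  shows "\<exists>B1. path_component SL_R B B1 \<and> det B1 = 1 \<and> idrows S B1 \<and> B1$j$j = 1"
proof -
  define c where "c = (1 - B$j$j) / B$l$j"
  define u where "u = c *s (axis l 1 :: real^'n)"
  have u: "u $ j = 0"
    using assms(4) by (simp add: u_def axis_def)
  have sum_u: "(\<Sum>r\<in>UNIV. u$r * B$r$m) = c * B$l$m" for m
  proof -
    have "u$r * B$r$m = (if r = l then c * B$l$m else 0)" for r
      by (simp add: u_def axis_def)
    then show ?thesis
      by (simp add: sum.delta')
  qed
  show ?thesis
  proof (intro exI conjI)
    show "path_component SL_R B (shear j u ** B)"
      by (rule path_component_SL_shear(1)[OF assms(1) u])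
    show "det (shear j u ** B) = 1"
      using assms(1) by (simp add: det_mul det_shear[OF u])
    show "idrows S (shear j u ** B)"
      using assms(2,3) unfolding idrows_def shear_mult_nth by auto
    show "(shear j u ** B) $ j $ j = 1"
      using assms(5) unfolding shear_mult_nth sum_u by (simp add: c_def)
  qed
qed

text \<open>
  If column j vanishes off the diagonal, B_jj \<noteq> 0; adding row j to another non-identity row k
  produces an entry B_kj \<noteq> 0, to which the previous lemma applies.
\<close>
lemma pivot_from_diagonal:
  fixes B :: "real^'n^'n"
  assumes B: "det B = 1" "idrows S B" and j: "j \<in> S" and k: "k \<in> S" "k \<noteq> j"
    and column: "\<forall>l. l \<noteq> j \<longrightarrow> B$l$j = 0"
  shows "\<exists>B1. path_component SL_R B B1 \<and> det B1 = 1 \<and> idrows S B1 \<and> B1$j$j = 1"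
proof -
  have "B$j$j \<noteq> 0"
  proof
    assume "B$j$j = 0"
    then have "column j B = 0"
      using column by (auto simp: column_def vec_eq_iff)
    then show False
      using B(1) det_zero_column by fastforce
  qed
  define u where "u = (axis j 1 :: real^'n)"
  have u: "u $ k = 0"
    using k(2) by (simp add: u_def axis_def)
  have sum_u: "(\<Sum>r\<in>UNIV. u$r * B$r$m) = B$j$m" for m
  proof -
    have "u$r * B$r$m = (if r = j then B$j$m else 0)" for r
      by (simp add: u_def axis_def)
    then show ?thesis
      by (simp add: sum.delta')
  qed
  let ?B' = "shear k u ** B"
  have path: "path_component SL_R B ?B'"
    by (rule path_component_SL_shear(1)[OF B(1) u])
  have det: "det ?B' = 1"
    using B(1) by (simp add: det_mul det_shear[OF u])
  have idrows: "idrows S ?B'"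
    using B(2) k(1) unfolding idrows_def shear_mult_nth by auto
  have "?B' $ k $ j \<noteq> 0"
    using k(2) column \<open>B$j$j \<noteq> 0\<close> unfolding shear_mult_nth sum_u by auto
  then show ?thesis
    using pivot_from_row[OF det idrows j k(2)] path path_component_trans by blast
qed

text \<open>Any pivot position j \<in> S can be normalised to B_jj = 1.\<close>
lemma pivot:
  fixes B :: "real^'n^'n"
  assumes B: "det B = 1" "idrows S B" and j: "j \<in> S"
  shows "\<exists>B1. path_component SL_R B B1 \<and> det B1 = 1 \<and> idrows S B1 \<and> B1$j$j = 1"
proof -
  consider (row) l where "l \<noteq> j" "B$l$j \<noteq> 0"
    | (single) "\<forall>l. l \<noteq> j \<longrightarrow> B$l$j = 0" "S = {j}"
    | (other) k where "\<forall>l. l \<noteq> j \<longrightarrow> B$l$j = 0" "k \<in> S" "k \<noteq> j"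
    using j by blast
  then show ?thesis
  proof cases
    case row
    then show ?thesis
      using pivot_from_row B j by blast
  next
    case single
    text \<open>Here B differs from 1 only in row j, so B_jj = det B = 1 already.\<close>
    then have "B$j$j = 1"
      using B det_single_row[of j B] by simp
    then show ?thesis
      using B path_component_refl[of B SL_R] by (auto simp: SL_R_def)
  next
    case other
    then show ?thesis
      using pivot_from_diagonal B j by blast
  qed
qed

text \<open>With pivot B_jj = 1, shears clear column j and row j, turning row j into an identity row.\<close>
lemma clear_pivot_row_column:
  fixes B :: "real^'n^'n"
  assumes B: "det B = 1" "idrows (insert j S) B" "B$j$j = 1"
  shows "\<exists>B'. path_component SL_R B B' \<and> det B' = 1 \<and> idrows S B'"
proof -
  define c :: "real^'n" where "c = (\<chi> i. if i = j then 0 else B$i$j)"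
  define B2 where "B2 = transpose (shear j (-c)) ** B"
  have c: "(-c) $ j = 0"
    by (simp add: c_def)
  have B2: "B2$i$m = B$i$m - c$i * B$j$m" for i m
    unfolding B2_def transpose_shear_mult_nth by simp
  have det2: "det B2 = 1"
    using B(1) by (simp add: B2_def det_mul det_shear[OF c])
  define r :: "real^'n" where "r = (\<chi> m. if m = j then 0 else B2$j$m)"
  define B3 where "B3 = B2 ** shear j (-r)"
  have r: "(-r) $ j = 0"
    by (simp add: r_def)
  have B3: "B3$i$m = B2$i$m - B2$i$j * r$m" for i m
    unfolding B3_def mult_shear_nth by simp
  have column_j: "B2$i$j = (if i = j then 1 else 0)" for i
    using B2[of i j] B(3) by (simp add: c_def)
  have "idrows S B3"
    unfolding idrows_def
  proof (intro allI impI)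
    fix i m assume i: "i \<notin> S"
    show "B3$i$m = (if i = m then 1 else 0)"
    proof (cases "i = j")
      case True
      then show ?thesis
        using B3[of j m] column_j[of j] by (cases "m = j") (simp_all add: r_def)
    next
      case False
      then have "B$i$m = (if i = m then 1 else 0)" "B$i$j = 0"
        using B(2) i unfolding idrows_def by auto
      then show ?thesis
        using B3[of i m] column_j[of i] B2[of i m] False by (simp add: c_def)
    qed
  qed
  moreover have "path_component SL_R B B3"
    using path_component_SL_shear(2)[OF B(1) c] path_component_SL_shear(3)[OF det2 r]
      path_component_trans unfolding B2_def B3_def by blast
  moreover have "det B3 = 1"
    using det2 by (simp add: B3_def det_mul det_shear[OF r])
  ultimately show ?thesis
    by blast
qed

text \<open>Gaussian elimination by shears, one row index at a time.\<close>
lemma SL_elimination: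
  fixes B :: "real^'n^'n"
  assumes "finite S" "det B = 1" "idrows S B"
  shows "path_component SL_R B (mat 1)"
  using assms
proof (induction S arbitrary: B rule: finite_induct)
  case empty
  then have "B = mat 1"
    by (auto simp: idrows_def vec_eq_iff mat_def)
  then show ?case
    using path_component_refl[of "mat 1" SL_R] by (simp add: SL_R_def)
next
  case (insert j S)
  obtain B1 where B1: "path_component SL_R B B1" "det B1 = 1" "idrows (insert j S) B1" "B1$j$j = 1"
    using pivot[OF insert.prems] by blast
  obtain B' where "path_component SL_R B1 B'" "det B' = 1" "idrows S B'"
    using clear_pivot_row_column[OF B1(2-4)] by blast
  then show ?case
    using insert.IH B1(1) path_component_trans by blast
qed

text \<open>Every matrix of SL_n R is connected to the identity, so SL_n R is path connected.\<close>
theorem path_connected_SL: "path_connected (SL_R :: (real^'n^'n) set)"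
  unfolding path_connected_component
proof (intro ballI)
  fix A B :: "real^'n^'n" assume "A \<in> SL_R" "B \<in> SL_R"
  then have "path_component SL_R A (mat 1)" "path_component SL_R B (mat 1)"
    using SL_elimination[of UNIV] by (auto simp: SL_R_def idrows_def)
  then show "path_component SL_R A B"
    using path_component_sym path_component_trans by blast
qed

subsection \<open>Discreteness of \<Gamma> and compactness of SO_n\<close>

text \<open>Distinct integer matrices have distance at least 1, so bounded sets of them are finite.\<close>
lemma finite_bounded_integer_matrices:
  fixes T :: "(real^'n^'m) set"
  assumes "bounded T" "\<And>A i j. A \<in> T \<Longrightarrow> A$i$j \<in> \<int>"
  shows "finite T"
proof -
  have "uniform_discrete T"
    unfolding uniform_discrete_def
  proof (intro exI[of _ 1] conjI ballI impI)
    fix A B assume A: "A \<in> T" and B: "B \<in> T" and "dist A B < 1"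
    have "A$i$j = B$i$j" for i j
    proof -
      have "\<bar>A$i$j - B$i$j\<bar> \<le> norm ((A - B) $ i)"
        using component_le_norm_cart[of "(A - B) $ i" j] by simp
      also have "\<dots> \<le> dist A B"
        unfolding dist_norm by (rule Finite_Cartesian_Product.norm_nth_le)
      finally have "\<bar>A$i$j - B$i$j\<bar> < 1"
        using \<open>dist A B < 1\<close> by linarith
      then show ?thesis
        using Ints_eq_abs_less1 assms(2)[OF A] assms(2)[OF B] by blast
    qed
    then show "A = B"
      by (simp add: vec_eq_iff)
  qed simp
  then show ?thesis
    using uniform_discrete_finite_iff assms(1) by blast
qed

text \<open>SL_n R is closed and SO_n is compact (its rows are unit vectors).\<close>
lemma closed_SL: "closed (SL_R :: (real^'n^'n) set)"
  unfolding SL_R_def by (rule closed_Collect_eq) (auto intro!: continuous_intros)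

lemma compact_SO: "compact (SO_R :: (real^'n^'n) set)"
proof (rule compact_eq_bounded_closed[THEN iffD2], rule conjI)
  show "bounded (SO_R :: (real^'n^'n) set)"
    unfolding bounded_iff
  proof (intro exI[of _ "real CARD('n)"] ballI)
    fix A :: "real^'n^'n" assume "A \<in> SO_R"
    then have "norm (A$i) = 1" for i
      using orthogonal_matrix_orthonormal_rows[of A] by (simp add: SO_R_def row_def)
    moreover have "norm A \<le> (\<Sum>i\<in>UNIV. norm (A$i))"
      unfolding norm_vec_def by (rule L2_set_le_sum) auto
    ultimately show "norm A \<le> real CARD('n)"
      by simp
  qed
  have "closed {A::real^'n^'n. transpose A ** A = mat 1 \<and> det A = 1}"
    unfolding transpose_def by (intro closed_Collect_conj closed_Collect_eq continuous_intros)
  then show "closed (SO_R :: (real^'n^'n) set)"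
    by (simp add: SO_R_def orthogonal_matrix)
qed

text \<open>
  The elements g of \<Gamma> carrying SO_n Y into a compact set X on the right form a finite set:
  they are determined continuously by (k, y, k y g) \<in> SO_n \<times> Y \<times> X, hence bounded.
\<close>
lemma finite_Gamma_transporters:
  fixes \<Gamma> X Y :: "(real^'n^'n) set"
  assumes "is_subgroup_SL_Z \<Gamma>" "compact X" "compact Y" "Y \<subseteq> SL_R"
  shows "finite {g \<in> \<Gamma>. \<exists>k\<in>SO_R. \<exists>y\<in>Y. k ** y ** g \<in> X}"
proof (rule finite_bounded_integer_matrices)
  let ?solve = "\<lambda>(k, y, x). sl_solve (k ** y) x"
  have "compact (?solve ` (SO_R \<times> Y \<times> X))"
    by (intro compact_continuous_image compact_Times compact_SO assms(2,3))
      (auto simp: case_prod_unfold intro!: continuous_intros)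
  moreover have "{g \<in> \<Gamma>. \<exists>k\<in>SO_R. \<exists>y\<in>Y. k ** y ** g \<in> X} \<subseteq> ?solve ` (SO_R \<times> Y \<times> X)"
  proof
    fix g assume "g \<in> {g \<in> \<Gamma>. \<exists>k\<in>SO_R. \<exists>y\<in>Y. k ** y ** g \<in> X}"
    then obtain k y where "k \<in> SO_R" "y \<in> Y" "k ** y ** g \<in> X"
      by blast
    moreover have "det (k ** y) = 1"
      using calculation assms(4) SO_det[of k] by (auto simp: det_mul SL_R_def)
    then have "g = sl_solve (k ** y) (k ** y ** g)"
      by (intro sl_solve_unique) (simp_all add: matrix_mul_assoc)
    ultimately show "g \<in> ?solve ` (SO_R \<times> Y \<times> X)"
      by force
  qed
  ultimately show "bounded {g \<in> \<Gamma>. \<exists>k\<in>SO_R. \<exists>y\<in>Y. k ** y ** g \<in> X}"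
    using compact_imp_bounded bounded_subset by blast
  show "A$i$j \<in> \<int>" if "A \<in> {g \<in> \<Gamma>. \<exists>k\<in>SO_R. \<exists>y\<in>Y. k ** y ** g \<in> X}" for A i j
    using that assms(1) by (auto simp: is_subgroup_SL_Z_def SL_Z_def)
qed

text \<open>The part SO_n Y F of the double coset saturation of Y cut out by a set F of right factors.\<close>
definition saturate :: "(real^'n^'n) set \<Rightarrow> (real^'n^'n) set \<Rightarrow> (real^'n^'n) set" where
  "saturate Y F = {k ** y ** g |k y g. k \<in> SO_R \<and> y \<in> Y \<and> g \<in> F}"

lemma compact_saturate:
  assumes "compact Y" "finite F"
  shows "compact (saturate Y F)"
proof -
  have "saturate Y F = (\<lambda>(k, y, g). k ** y ** g) ` (SO_R \<times> Y \<times> F)"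
    unfolding saturate_def by force
  also have "compact \<dots>"
    by (intro compact_continuous_image compact_Times compact_SO assms finite_imp_compact)
      (auto simp: case_prod_unfold intro!: continuous_intros)
  finally show ?thesis .
qed

text \<open>In a normed space, closedness can be tested on closed balls.\<close>
lemma closed_if_closed_Int_cballs:
  fixes S :: "'a::real_normed_vector set"
  assumes "\<And>R. closed (S \<inter> cball 0 R)"
  shows "closed S"
  unfolding closed_sequential_limits
proof (intro allI impI)
  fix x l assume x: "(\<forall>n. x n \<in> S) \<and> x \<longlonglongrightarrow> l"
  then obtain R where "\<And>n. norm (x n) \<le> R"
    using convergent_imp_Bseq[OF convergentI] BseqE by metis
  then have "\<forall>n. x n \<in> S \<inter> cball 0 R"
    using x by simp
  then show "l \<in> S"
    using assms[of R] x closed_sequential_limits by blast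
qed

subsection \<open>Properness of the translated projection\<close>

text \<open>
  Throughout, h is a continuous family of elements of SL_n R over a compact parameter space T,
  and the homotopy in question is (x, t) \<mapsto> [h(t) x] on N \<times> T.
\<close>
context
  fixes \<Gamma> N :: "(real^'n^'n) set" and T :: "'a::euclidean_space set" and h :: "'a \<Rightarrow> real^'n^'n"
  assumes subgroup: "is_subgroup_SL_Z \<Gamma>" and N_SL: "N \<subseteq> SL_R"
    and cls_proper: "proper_map (top_of_set N) (M_top \<Gamma>) (cls \<Gamma>)"
    and T_compact: "compact T" and h_cont: "continuous_on T h" and h_SL: "h ` T \<subseteq> SL_R"
begin

text \<open>The translation (x, t) \<mapsto> h(t) x is continuous and preserves SL_n R.\<close>
lemma continuous_on_translate:
  assumes "S \<subseteq> UNIV \<times> T"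
  shows "continuous_on S (\<lambda>(x, t). h t ** x)"
proof -
  have "continuous_on S (\<lambda>p. h (snd p))"
    using assms by (intro continuous_on_compose2[OF h_cont]) (auto intro!: continuous_intros)
  then show ?thesis
    unfolding case_prod_unfold by (intro continuous_intros)
qed

lemma translate_SL: "x \<in> SL_R \<Longrightarrow> t \<in> T \<Longrightarrow> h t ** x \<in> SL_R"
  using h_SL by (auto simp: SL_R_def det_mul)

text \<open>The points of N whose class lies in the image of a compact set form a compact set.\<close>
lemma compact_cls_preimage:
  assumes "compact A" "A \<subseteq> SL_R"
  shows "compact {x \<in> N. cls \<Gamma> x \<in> cls \<Gamma> ` A}"
proof -
  have "compactin (M_top \<Gamma>) (cls \<Gamma> ` A)"
    using assms quotient_imp_continuous_map[OF quotient_map_cls]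
    by (intro image_compactin[of "top_of_set SL_R"]) (auto simp: compactin_subtopology)
  from compactin_proper_map_preimage[OF cls_proper this]
  show ?thesis
    by (simp add: compactin_subtopology)
qed

text \<open>The matrices a with h(t) a \<in> SO_n K for some t \<in> T.\<close>
definition back_translate :: "(real^'n^'n) set \<Rightarrow> (real^'n^'n) set" where
  "back_translate K = (\<lambda>(t, k, y). sl_solve (h t) (k ** y)) ` (T \<times> SO_R \<times> K)"

lemma compact_back_translate:
  assumes K: "compact K" "K \<subseteq> SL_R"
  shows "compact (back_translate K)" "back_translate K \<subseteq> SL_R"
proof -
  have "continuous_on (T \<times> SO_R \<times> K) (\<lambda>p. h (fst p))"
    by (intro continuous_on_compose2[OF h_cont]) (auto intro!: continuous_intros)
  then show "compact (back_translate K)"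
    unfolding back_translate_def case_prod_unfold
    by (intro compact_continuous_image compact_Times T_compact compact_SO K(1) continuous_intros)
  show "back_translate K \<subseteq> SL_R"
  proof
    fix a assume "a \<in> back_translate K"
    then obtain t k y where "t \<in> T" "k \<in> SO_R" "y \<in> K" "a = sl_solve (h t) (k ** y)"
      by (auto simp: back_translate_def)
    moreover have "det (k ** y) = 1"
      using calculation K(2) SO_det[of k] by (auto simp: det_mul SL_R_def)
    ultimately show "a \<in> SL_R"
      using h_SL det_sl_solve by (auto simp: SL_R_def)
  qed
qed

text \<open>If h(t) x = k y g, then x = a g with h(t) a = k y, so [x] = [a] for a back translate a.\<close>
lemma cls_in_back_translate:
  assumes "t \<in> T" "k \<in> SO_R" "y \<in> K" "g \<in> \<Gamma>" and x: "h t ** x = k ** y ** g"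
  shows "cls \<Gamma> x \<in> cls \<Gamma> ` back_translate K"
proof -
  define a where "a = x ** matrix_inv g"
  have "x = a ** g"
    using subgroup_inverse(3)[OF subgroup assms(4)] by (simp add: a_def matrix_mul_assoc[symmetric])
  then have "cls \<Gamma> x = cls \<Gamma> a"
    using cls_eq[OF subgroup SO_id assms(4), of a] by simp
  have "h t ** a = (h t ** x) ** matrix_inv g"
    by (simp add: a_def matrix_mul_assoc)
  also have "\<dots> = k ** y ** (g ** matrix_inv g)"
    using x by (simp add: matrix_mul_assoc)
  finally have "h t ** a = k ** y"
    using subgroup_inverse(2)[OF subgroup assms(4)] by simp
  then have "a = sl_solve (h t) (k ** y)"
    using h_SL assms(1) by (intro sl_solve_unique) (auto simp: SL_R_def)
  then have "a \<in> back_translate K"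
    using assms(1-3) unfolding back_translate_def by (auto intro!: image_eqI[where x="(t, k, y)"])
  then show ?thesis
    using \<open>cls \<Gamma> x = cls \<Gamma> a\<close> by blast
qed

text \<open>
  The key compactness statement: the preimage of the classes of a compact set K is compact.
  Its points (x, t) have x in the compact set P below, and h(t) x \<in> SO_n K F for a finite F.
\<close>
lemma compact_translate_preimage:
  assumes K: "compact K" "K \<subseteq> SL_R"
  shows "compact {(x, t) \<in> N \<times> T. cls \<Gamma> (h t ** x) \<in> cls \<Gamma> ` K}"
proof -
  define P where "P = {x \<in> N. cls \<Gamma> x \<in> cls \<Gamma> ` back_translate K}"
  have P: "compact P"
    unfolding P_def using compact_back_translate[OF K] by (rule compact_cls_preimage)
  define F where "F = {g \<in> \<Gamma>. \<exists>k\<in>SO_R. \<exists>y\<in>K. k ** y ** g \<in> (\<lambda>(x, t). h t ** x) ` (P \<times> T)}"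
  have "finite F"
    unfolding F_def using K P T_compact continuous_on_translate[of "P \<times> T"]
    by (intro finite_Gamma_transporters[OF subgroup] compact_continuous_image compact_Times) auto
  have "{(x, t) \<in> N \<times> T. cls \<Gamma> (h t ** x) \<in> cls \<Gamma> ` K}
      = (P \<times> T) \<inter> (\<lambda>(x, t). h t ** x) -` saturate K F"
  proof (intro equalityI subsetI)
    fix p assume "p \<in> {(x, t) \<in> N \<times> T. cls \<Gamma> (h t ** x) \<in> cls \<Gamma> ` K}"
    then obtain x t y where p: "p = (x, t)" "x \<in> N" "t \<in> T" "y \<in> K" "cls \<Gamma> (h t ** x) = cls \<Gamma> y"
      by auto
    then obtain k g where kg: "k \<in> SO_R" "g \<in> \<Gamma>" "h t ** x = k ** y ** g"
      using cls_eqD[OF subgroup] by blast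
    then have "x \<in> P"
      using cls_in_back_translate p(2-4) by (simp add: P_def)
    then have "h t ** x \<in> (\<lambda>(x, t). h t ** x) ` (P \<times> T)"
      using p(3) by force
    then have "g \<in> F"
      using kg(1,2) p(4) unfolding F_def kg(3) by blast
    then have "h t ** x \<in> saturate K F"
      unfolding saturate_def using kg p(4) by blast
    then show "p \<in> (P \<times> T) \<inter> (\<lambda>(x, t). h t ** x) -` saturate K F"
      using \<open>x \<in> P\<close> p(1,3) by simp
  next
    fix p assume "p \<in> (P \<times> T) \<inter> (\<lambda>(x, t). h t ** x) -` saturate K F"
    then obtain x t k y g where p: "p = (x, t)" "x \<in> N" "t \<in> T"
      and kg: "k \<in> SO_R" "y \<in> K" "g \<in> F" "h t ** x = k ** y ** g"
      unfolding saturate_def P_def by auto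
    then have "cls \<Gamma> (h t ** x) = cls \<Gamma> y"
      using cls_eq[OF subgroup kg(1)] by (simp add: F_def)
    then show "p \<in> {(x, t) \<in> N \<times> T. cls \<Gamma> (h t ** x) \<in> cls \<Gamma> ` K}"
      using p kg(2) by auto
  qed
  moreover have "compact ((P \<times> T) \<inter> (\<lambda>(x, t). h t ** x) -` saturate K F)"
    using compact_imp_closed[OF compact_saturate[OF K(1) \<open>finite F\<close>]]
      continuous_on_translate[of "P \<times> T"]
    by (intro proper_map_from_compact[where T=UNIV] compact_Times P T_compact) auto
  ultimately show ?thesis
    by simp
qed

text \<open>The homotopy is continuous as the composition of the translation with the projection.\<close>
lemma continuous_map_translate:
  "continuous_map (top_of_set (N \<times> T)) (M_top \<Gamma>) (\<lambda>(x, t). cls \<Gamma> (h t ** x))"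
proof -
  have "continuous_map (top_of_set (N \<times> T)) (top_of_set SL_R) (\<lambda>(x, t). h t ** x)"
    using continuous_on_translate[of "N \<times> T"] N_SL translate_SL by auto
  from continuous_map_compose[OF this quotient_imp_continuous_map[OF quotient_map_cls]]
  show ?thesis
    by (simp add: o_def case_prod_unfold)
qed

text \<open>The translates h(t) x of the points of a closed set C mapping into [K] form a compact set.\<close>
lemma compact_translate_closed_part:
  assumes C: "closedin (top_of_set (N \<times> T)) C" and K: "compact K" "K \<subseteq> SL_R"
  shows "compact ((\<lambda>(x, t). h t ** x) ` (C \<inter> {(x, t) \<in> N \<times> T. cls \<Gamma> (h t ** x) \<in> cls \<Gamma> ` K}))"
proof -
  obtain U where "closed U" "C = U \<inter> (N \<times> T)"
    using C unfolding closedin_closed by blast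
  then have "C \<inter> {(x, t) \<in> N \<times> T. cls \<Gamma> (h t ** x) \<in> cls \<Gamma> ` K}
      = U \<inter> {(x, t) \<in> N \<times> T. cls \<Gamma> (h t ** x) \<in> cls \<Gamma> ` K}"
    by blast
  then have "compact (C \<inter> {(x, t) \<in> N \<times> T. cls \<Gamma> (h t ** x) \<in> cls \<Gamma> ` K})"
    using closed_Int_compact[OF \<open>closed U\<close> compact_translate_preimage[OF K]] by simp
  then show ?thesis
    by (intro compact_continuous_image continuous_on_translate) auto
qed

text \<open>
  The saturation S of the image of a closed set C is closed near every point: on a ball, only
  finitely many elements of \<Gamma> contribute, so S is locally a compact set SO_n Y F.
\<close>
lemma closed_saturation_Int_cball:
  assumes C: "closedin (top_of_set (N \<times> T)) C"
  shows "closed ({z \<in> SL_R. cls \<Gamma> z \<in> (\<lambda>(x, t). cls \<Gamma> (h t ** x)) ` C} \<inter> cball 0 R)"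
    (is "closed (?S \<inter> _)")
proof -
  have CNT: "C \<subseteq> N \<times> T"
    using closedin_subset[OF C] by simp
  define Bd where "Bd = cball 0 R \<inter> (SL_R :: (real^'n^'n) set)"
  have Bd: "compact Bd" "Bd \<subseteq> SL_R"
    unfolding Bd_def using compact_Int_closed[OF compact_cball closed_SL] by simp_all
  define Y where "Y = (\<lambda>(x, t). h t ** x) ` (C \<inter> {(x, t) \<in> N \<times> T. cls \<Gamma> (h t ** x) \<in> cls \<Gamma> ` Bd})"
  have Y: "compact Y" "Y \<subseteq> SL_R"
    unfolding Y_def using compact_translate_closed_part[OF C Bd] N_SL translate_SL by auto
  define F where "F = {g \<in> \<Gamma>. \<exists>k\<in>SO_R. \<exists>y\<in>Y. k ** y ** g \<in> Bd}"
  have "finite F"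
    unfolding F_def by (rule finite_Gamma_transporters[OF subgroup Bd(1) Y])
  have "?S \<inter> cball 0 R = cball 0 R \<inter> saturate Y F"
  proof (intro equalityI subsetI)
    fix z assume z: "z \<in> ?S \<inter> cball 0 R"
    then obtain x t where xt: "(x, t) \<in> C" "cls \<Gamma> z = cls \<Gamma> (h t ** x)"
      by auto
    then obtain k g where kg: "k \<in> SO_R" "g \<in> \<Gamma>" "z = k ** (h t ** x) ** g"
      using cls_eqD[OF subgroup] by blast
    have "z \<in> Bd"
      using z by (simp add: Bd_def)
    then have "cls \<Gamma> (h t ** x) \<in> cls \<Gamma> ` Bd"
      using xt(2) by (metis image_eqI)
    then have "h t ** x \<in> Y"
      using xt(1) CNT unfolding Y_def by force
    moreover have "g \<in> F"
      using kg \<open>h t ** x \<in> Y\<close> \<open>z \<in> Bd\<close> unfolding F_def by blast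
    ultimately have "z \<in> saturate Y F"
      using kg(1,3) unfolding saturate_def by blast
    then show "z \<in> cball 0 R \<inter> saturate Y F"
      using z by blast
  next
    fix z assume z: "z \<in> cball 0 R \<inter> saturate Y F"
    then obtain k y g where "k \<in> SO_R" "y \<in> Y" "g \<in> F" "z = k ** y ** g"
      unfolding saturate_def by blast
    then obtain x t where kg: "k \<in> SO_R" "(x, t) \<in> C" "g \<in> \<Gamma>" "z = k ** (h t ** x) ** g"
      unfolding Y_def F_def by auto
    moreover have "h t ** x \<in> SL_R"
      using kg(2) CNT N_SL translate_SL by blast
    ultimately have "det z = 1" "cls \<Gamma> z = cls \<Gamma> (h t ** x)"
      using SO_det[of k] subgroup_det[OF subgroup] cls_eq[OF subgroup]
      by (simp_all add: SL_R_def det_mul)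
    then show "z \<in> ?S \<inter> cball 0 R"
      using z \<open>(x, t) \<in> C\<close> unfolding SL_R_def by force
  qed
  then show ?thesis
    using compact_saturate[OF Y(1) \<open>finite F\<close>] by (simp add: closed_Int compact_imp_closed)
qed

text \<open>The homotopy is a closed map: the saturation of the image of a closed set is closed.\<close>
lemma closed_map_translate:
  "closed_map (top_of_set (N \<times> T)) (M_top \<Gamma>) (\<lambda>(x, t). cls \<Gamma> (h t ** x))"
  unfolding closed_map_def
proof (intro allI impI)
  fix C assume C: "closedin (top_of_set (N \<times> T)) C"
  let ?H = "\<lambda>(x, t). cls \<Gamma> (h t ** x)"
  have "closedin (top_of_set SL_R) {z \<in> SL_R. cls \<Gamma> z \<in> ?H ` C}"
    using closed_if_closed_Int_cballs[OF closed_saturation_Int_cball[OF C]]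
    by (simp add: closed_subset)
  moreover have "?H ` C \<subseteq> topspace (M_top \<Gamma>)"
    unfolding topspace_M_top using closedin_subset[OF C] N_SL translate_SL by fastforce
  ultimately show "closedin (M_top \<Gamma>) (?H ` C)"
    using quotient_map_cls[of \<Gamma>] unfolding quotient_map_closedin by simp
qed

text \<open>The homotopy is proper: a closed map whose fibres are instances of the key lemma.\<close>
lemma proper_map_translate:
  "proper_map (top_of_set (N \<times> T)) (M_top \<Gamma>) (\<lambda>(x, t). cls \<Gamma> (h t ** x))"
  unfolding proper_map_def
proof (intro conjI ballI closed_map_translate)
  fix y assume "y \<in> topspace (M_top \<Gamma>)"
  then obtain y0 where y0: "y0 \<in> SL_R" "y = cls \<Gamma> y0"
    unfolding topspace_M_top by blast
  have "{p \<in> topspace (top_of_set (N \<times> T)). (\<lambda>(x, t). cls \<Gamma> (h t ** x)) p = y}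
      = {(x, t) \<in> N \<times> T. cls \<Gamma> (h t ** x) \<in> cls \<Gamma> ` {y0}}"
    using y0 by auto
  then show "compactin (top_of_set (N \<times> T))
      {p \<in> topspace (top_of_set (N \<times> T)). (\<lambda>(x, t). cls \<Gamma> (h t ** x)) p = y}"
    using compact_translate_preimage[of "{y0}"] y0 by (auto simp: compactin_subtopology)
qed

end

subsection \<open>The theorem\<close>

theorem mainTheorem4:
  fixes \<Gamma> :: "(real^'n^'n) set" and N :: "(real^'n^'n) set" and B :: "real^'n^'n"
  assumes "is_subgroup_SL_Z \<Gamma>"
    and "finite_index_SL_Z \<Gamma>"
    and "torsion_free \<Gamma>"
    and "N \<subseteq> SL_R"
    and "proper_map (top_of_set N) (M_top \<Gamma>) (cls \<Gamma>)"
    and "B \<in> SL_R"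
  shows "\<exists>H. continuous_map (prod_topology (top_of_set N) (top_of_set {0..1::real})) (M_top \<Gamma>) H
           \<and> proper_map (prod_topology (top_of_set N) (top_of_set {0..1::real})) (M_top \<Gamma>) H
           \<and> (\<forall>x\<in>N. H (x, 0) = cls \<Gamma> x \<and> H (x, 1) = cls \<Gamma> (B ** x))"
proof -
  have "mat 1 \<in> (SL_R :: (real^'n^'n) set)"
    by (simp add: SL_R_def)
  then obtain h where h: "path h" "path_image h \<subseteq> SL_R" "pathstart h = mat 1" "pathfinish h = B"
    using path_connected_SL assms(6) unfolding path_connected_def by blast
  have "continuous_on {0..1} h" "h ` {0..1} \<subseteq> SL_R"
    using h(1,2) unfolding path_def path_image_def by simp_all
  note homotopy = assms(1,4,5) compact_Icc this
  have "prod_topology (top_of_set N) (top_of_set {0..1::real}) = top_of_set (N \<times> {0..1})"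
    by simp
  moreover have "\<forall>x\<in>N. cls \<Gamma> (h 0 ** x) = cls \<Gamma> x \<and> cls \<Gamma> (h 1 ** x) = cls \<Gamma> (B ** x)"
    using h(3,4) unfolding pathstart_def pathfinish_def by simp
  ultimately show ?thesis
    using continuous_map_translate[OF homotopy] proper_map_translate[OF homotopy]
    by (intro exI[of _ "\<lambda>(x, t). cls \<Gamma> (h t ** x)"]) auto
qed

end
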